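(* Let $\beta,\gamma>0$ be fixed. If a pair $(\mathbf{x}^\star,\mathbf{y}^\star)\in\mathbb{R}^N\times\mathbb{R}^N$ is a global minimizer of $F$ over $\mathbb{R}^N\times\mathbb{R}^N$, then $$\mathbf{x}^\star\in\mathrm{prox}_{\beta\|\cdot\|_0}(\mathbf{y}^\star),\qquad \mathbf{y}^\star=\mathbf{x}^\star-\frac{\beta}{\gamma}\mathbf{K}^*(\mathbf{K}\mathbf{y}^\star-\mathbf{r}).$$ Conversely, if a pair $(\mathbf{x}^\star,\mathbf{y}^\star)\in\mathbb{R}^N\times\mathbb{R}^N$ satisfies these two relations, then $(\mathbf{x}^\star,\mathbf{y}^\star)$ is a local minimizer of $F$.
   Context: Let $d,M,N$ be positive integers with $d<M\le N$. $\mathbf{F}$ is the $M\times M$ discrete Fourier matrix $\mathbf{F}_{mn}=\frac{1}{\sqrt{M}}\exp\left(-i\frac{2\pi(m-1)(n-1)}{M}\right)$. $\mathbf{R}$ is a $d\times M$ row selector matrix: it consists of $d$ distinct rows of the $M\times M$ identity matrix, chosen so that for $2\le m\le M$, if the $m$-th row is included then so is the $(M-m+2)$-th row. $\mathbf{W}$ is an $N\times M$ tight framelet matrix, i.e. a real matrix with $\mathbf{W}^*\mathbf{W}=\mathbf{I}$. Put $\mathbf{K}:=\mathbf{R}\mathbf{F}\mathbf{W}^*$ (a complex $d\times N$ matrix; $*$ is conjugate transpose). The vector $\mathbf{r}\in\mathbb{R}^d$ is fixed and such that $\mathbf{K}^*\mathbf{r}\in\mathbb{R}^N$. $\|\cdot\|_2$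 is the Euclidean norm (on $\mathbb{R}^N$ or $\mathbb{C}^d$). $\|\mathbf{x}\|_0$ is the number of nonzero components of $\mathbf{x}\in\mathbb{R}^N$. For $\mathbf{x},\mathbf{y}\in\mathbb{R}^N$, $$F(\mathbf{x},\mathbf{y}):=\tfrac12\|\mathbf{K}\mathbf{y}-\mathbf{r}\|_2^2+\tfrac{\gamma}{2\beta}\|\mathbf{x}-\mathbf{y}\|_2^2+\gamma\|\mathbf{x}\|_0 .$$ $\mathrm{prox}_{\beta\|\cdot\|_0}(\mathbf{z})$ is the (nonempty) set of minimizers of $\mathbf{x}\mapsto\frac{1}{2\beta}\|\mathbf{x}-\mathbf{z}\|_2^2+\|\mathbf{x}\|_0$ over $\mathbf{x}\in\mathbb{R}^N$. $(\mathbf{x}^\star,\mathbf{y}^\star)$ is a local minimizer of $F$ if there is $\delta>0$ such that $F(\mathbf{x}^\star,\mathbf{y}^\star)\le F(\mathbf{x}^\star+\Delta\mathbf{x},\mathbf{y}^\star+\Delta\mathbf{y})$ for all $\|\Delta\mathbf{x}\|\le\delta$, $\|\Delta\mathbf{y}\|\le\delta$. *)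

theory Defs
  imports "HOL-Analysis.Analysis"
begin

definition cmat :: "real^'n^'m \<Rightarrow> complex^'n^'m" where
  "cmat A = (\<chi> i j. complex_of_real (A $ i $ j))"

definition cvec :: "real^'n \<Rightarrow> complex^'n" where
  "cvec v = (\<chi> i. complex_of_real (v $ i))"

definition conj_transpose :: "complex^'n^'m \<Rightarrow> complex^'m^'n" where
  "conj_transpose A = (\<chi> i j. cnj (A $ j $ i))"

text \<open>
  A finite linearly ordered type with \<open>M\<close> elements plays the role of \<open>{1, \<dots>, M}\<close>.  The
  \<^emph>\<open>position\<close> of an element is its one-based rank, so \<^term>\<open>position\<close> is the unique
  order isomorphism from the type onto \<open>{1, \<dots>, M}\<close>.
\<close>
definition position :: "'m::{finite,linorder} \<Rightarrow> nat" where
  "position i = card {j. j \<le> i}"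

definition fourier_matrix :: "complex^('m::{finite,linorder})^('m::{finite,linorder})" where
  "fourier_matrix = (\<chi> m n. complex_of_real (1 / sqrt (real CARD('m))) *
     exp (- \<i> * complex_of_real
       (2 * pi * (real (position m) - 1) * (real (position n) - 1) / real CARD('m))))"

text \<open>
  The selected rows may be listed in any order.  In the last conjunct
  \<open>2 \<le> position (\<sigma> k) \<le> CARD('m)\<close>, so the subtraction on natural numbers does not truncate.
\<close>
definition row_selector :: "complex^('m::{finite,linorder})^'d \<Rightarrow> bool" where
  "row_selector R \<longleftrightarrow> (\<exists>\<sigma> :: 'd \<Rightarrow> 'm. inj \<sigma> \<and>
     (\<forall>k. row k R = row (\<sigma> k) (mat 1)) \<and>
     (\<forall>k. 2 \<le> position (\<sigma> k) \<longrightarrow>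
        (\<exists>l. position (\<sigma> l) = CARD('m) - position (\<sigma> k) + 2)))"

text \<open>The conjugate transpose of a real matrix is its transpose.\<close>
definition tight_framelet :: "real^'m^'n \<Rightarrow> bool" where
  "tight_framelet W \<longleftrightarrow> transpose W ** W = mat 1"

definition K_matrix ::
    "complex^('m::{finite,linorder})^'d \<Rightarrow> real^('m::{finite,linorder})^'n \<Rightarrow> complex^'n^'d" where
  "K_matrix R W = R ** fourier_matrix ** conj_transpose (cmat W)"

definition l0 :: "real^'n \<Rightarrow> nat" where
  "l0 x = card {i. x $ i \<noteq> 0}"

definition objective ::
    "complex^'n^'d \<Rightarrow> real^'d \<Rightarrow> real \<Rightarrow> real \<Rightarrow> real^'n \<Rightarrow> real^'n \<Rightarrow> real" where
  "objective K r \<beta> \<gamma> x y =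
     1 / 2 * (norm (K *v cvec y - cvec r))\<^sup>2 + \<gamma> / (2 * \<beta>) * (norm (x - y))\<^sup>2 + \<gamma> * real (l0 x)"

definition prox_l0 :: "real \<Rightarrow> real^'n \<Rightarrow> (real^'n) set" where
  "prox_l0 \<beta> z =
     {x. is_arg_min (\<lambda>u. 1 / (2 * \<beta>) * (norm (u - z))\<^sup>2 + real (l0 u)) (\<lambda>_. True) x}"

definition global_minimizer :: "('a \<Rightarrow> 'b \<Rightarrow> real) \<Rightarrow> 'a \<Rightarrow> 'b \<Rightarrow> bool" where
  "global_minimizer F x y \<longleftrightarrow> (\<forall>u v. F x y \<le> F u v)"

definition local_minimizer ::
    "('a::real_normed_vector \<Rightarrow> 'b::real_normed_vector \<Rightarrow> real) \<Rightarrow> 'a \<Rightarrow> 'b \<Rightarrow> bool" where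
  "local_minimizer F x y \<longleftrightarrow>
     (\<exists>\<delta>>0. \<forall>dx dy. norm dx \<le> \<delta> \<longrightarrow> norm dy \<le> \<delta> \<longrightarrow> F x y \<le> F (x + dx) (y + dy))"

end

theory Submission
  imports Defs
begin

text \<open>
  The objective is quadratic in \<open>y\<close>, and minimality in \<open>x\<close> is exactly the prox condition, so a
  global minimizer satisfies \<open>y = x - \<beta>/\<gamma> Re (K\<^sup>* (K y - r))\<close>.  The real part can be dropped:
  the selected rows of the Fourier matrix come in complex conjugate pairs, which makes
  \<open>K\<^sup>* K\<close> a real matrix.

  Conversely, under the two relations the increment of the objective at \<open>(dx, dy)\<close> equals
  \<open>1/2 \<parallel>K dy\<parallel>\<^sup>2 + \<gamma>/(2\<beta>) \<parallel>dx - dy\<parallel>\<^sup>2 + \<gamma>/\<beta> \<langle>x - y, dx\<rangle> + \<gamma> (\<parallel>x + dx\<parallel>\<^sub>0 - \<parallel>x\<parallel>\<^sub>0)\<close>.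
  The prox condition forces \<open>x\<^sub>i = y\<^sub>i\<close> on the support of \<open>x\<close>; off the support each nonzero
  \<open>dx\<^sub>i\<close> raises the last term by \<open>\<gamma>\<close>, which for small \<open>dx\<close> dominates \<open>\<gamma>/\<beta> y\<^sub>i dx\<^sub>i\<close>.
\<close>

section \<open>Real parts and the real adjoint of a complex matrix\<close>

definition Re_vec :: "complex^'n \<Rightarrow> real^'n" where
  "Re_vec z = (\<chi> i. Re (z $ i))"

lemma Re_vec_nth [simp]: "Re_vec z $ i = Re (z $ i)"
  by (simp add: Re_vec_def)

lemma cvec_nth [simp]: "cvec v $ i = complex_of_real (v $ i)"
  by (simp add: cvec_def)

lemma cvec_add: "cvec (u + v) = cvec u + cvec v"
  by (simp add: vec_eq_iff)

text \<open>The inner product on complex vectors is the real part of the Hermitian one. Hence the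
  gradient of the data term on real vectors is only the real part of the complex gradient.\<close>

lemma conj_transpose_adjoint:
  fixes K :: "complex^'n^'d"
  shows "(K *v cvec h) \<bullet> z = h \<bullet> Re_vec (conj_transpose K *v z)"
proof -
  have "(K *v cvec h) \<bullet> z = (\<Sum>k\<in>UNIV. \<Sum>i\<in>UNIV. h $ i * Re (cnj (K $ k $ i) * z $ k))"
    by (simp add: inner_vec_def matrix_vector_mult_def inner_complex_def sum_distrib_left
        sum_distrib_right algebra_simps flip: sum.distrib)
  also have "\<dots> = (\<Sum>i\<in>UNIV. \<Sum>k\<in>UNIV. h $ i * Re (cnj (K $ k $ i) * z $ k))"
    by (rule sum.swap)
  also have "\<dots> = h \<bullet> Re_vec (conj_transpose K *v z)"
    by (simp add: inner_vec_def matrix_vector_mult_def conj_transpose_def sum_distrib_left)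
  finally show ?thesis .
qed

lemma power2_norm_vec: "(norm (v :: real^'n))\<^sup>2 = (\<Sum>i\<in>UNIV. (v $ i)\<^sup>2)"
  unfolding power2_norm_eq_inner inner_vec_def by (simp add: power2_eq_square)

section \<open>Conjugate symmetry of the selected Fourier rows\<close>

lemma position_eq_iff: "position i = position j \<longleftrightarrow> i = j"
proof -
  have "position a < position b" if "a < b" for a b :: 'a
  proof -
    have "b \<in> {j. j \<le> b} - {j. j \<le> a}" and "{j. j \<le> a} \<subseteq> {j. j \<le> b}"
      using that by auto
    then show ?thesis
      unfolding position_def by (intro psubset_card_mono) auto
  qed
  then show ?thesis
    by (metis less_irrefl neqE)
qed

lemma position_pos: "0 < position i"
  unfolding position_def by (subst card_gt_0_iff) auto

lemma position_le: "position (i :: 'm::{finite,linorder}) \<le> CARD('m)"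
  unfolding position_def by (rule card_mono) auto

text \<open>Counted from zero, the two row indices add up to M, so the exponents are opposite up to
  an integer multiple of 2 pi i.\<close>

lemma fourier_matrix_reflect:
  fixes p q n :: "'m::{finite,linorder}"
  assumes "2 \<le> position p" and "position q = CARD('m) - position p + 2"
  shows "fourier_matrix $ q $ n = cnj (fourier_matrix $ p $ n)"
proof -
  let ?M = "real CARD('m)"
  define a where "a = 2 * pi * (real (position p) - 1) * (real (position n) - 1) / ?M"
  let ?b = "2 * pi * (real (position q) - 1) * (real (position n) - 1) / ?M"
  define k where "k = int (position n) - 1"
  have q: "real (position q) - 1 = ?M - (real (position p) - 1)"
    using assms position_le[of p] by (simp add: of_nat_diff)
  have b: "?b = 2 * pi * of_int k - a"
    unfolding q by (simp add: a_def k_def field_simps)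
  have "exp (- \<i> * complex_of_real ?b)
      = exp (\<i> * complex_of_real a) * exp (\<i> * complex_of_real (- (2 * pi * of_int k)))"
    unfolding b by (simp add: algebra_simps flip: exp_add)
  also have "exp (\<i> * complex_of_real (- (2 * pi * of_int k))) = 1"
    unfolding exp_eq_1 by (auto intro!: exI[of _ "- k"])
  finally show ?thesis
    by (simp add: fourier_matrix_def exp_cnj a_def)
qed

lemma fourier_matrix_first_real:
  assumes "position p = 1"
  shows "cnj (fourier_matrix $ p $ n) = fourier_matrix $ p $ n"
  using assms by (simp add: fourier_matrix_def)

text \<open>Reflection permutes the selected rows, and the first Fourier row is constant and real.
  As \<open>W\<close> is real, conjugation passes through the product with its transpose.\<close>

lemma K_matrix_rows_conjugate:
  fixes R :: "complex^('m::{finite,linorder})^'d" and W :: "real^('m::{finite,linorder})^'n"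
  assumes "row_selector R"
  obtains \<tau> :: "'d \<Rightarrow> 'd" where "bij \<tau>"
    and "\<And>k i. K_matrix R W $ \<tau> k $ i = cnj (K_matrix R W $ k $ i)"
proof -
  obtain \<sigma> :: "'d \<Rightarrow> 'm" where inj: "inj \<sigma>"
    and R: "\<And>k. row k R = row (\<sigma> k) (mat 1)"
    and sel: "\<And>k. 2 \<le> position (\<sigma> k) \<Longrightarrow> \<exists>l. position (\<sigma> l) = CARD('m) - position (\<sigma> k) + 2"
    using assms unfolding row_selector_def by blast
  have R': "R $ k $ m = (if \<sigma> k = m then 1 else 0)" for k m
    using R[of k] by (simp add: row_def vec_eq_iff mat_def)
  have RF: "(R ** fourier_matrix) $ k $ n = fourier_matrix $ \<sigma> k $ n" for k n
    by (simp add: matrix_matrix_mult_def R' if_distrib[where f="\<lambda>x. x * _"] cong: if_cong)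
  have K: "K_matrix R W $ k $ i
      = (\<Sum>n\<in>UNIV. fourier_matrix $ \<sigma> k $ n * complex_of_real (W $ i $ n))" for k i
    unfolding K_matrix_def matrix_matrix_mult_def[of "R ** fourier_matrix"]
    by (simp add: RF conj_transpose_def cmat_def)
  \<comment> \<open>Position 1 is its own partner and is treated apart, since the reflection formula
    would send it to M + 1.\<close>
  have "\<exists>l. if position (\<sigma> k) = 1 then l = k
      else position (\<sigma> l) = CARD('m) - position (\<sigma> k) + 2" for k
  proof (cases "position (\<sigma> k) = 1")
    case False
    then have "2 \<le> position (\<sigma> k)"
      using position_pos[of "\<sigma> k"] by linarith
    with False sel[of k] show ?thesis by simp
  qed auto
  then obtain \<tau> where \<tau>: "\<And>k. if position (\<sigma> k) = 1 then \<tau> k = k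
      else position (\<sigma> (\<tau> k)) = CARD('m) - position (\<sigma> k) + 2"
    by metis
  have ge2: "2 \<le> position (\<sigma> k)" if "position (\<sigma> k) \<noteq> 1" for k
    using position_pos[of "\<sigma> k"] that by linarith
  have "inj \<tau>"
  proof (rule injI)
    fix k l assume eq: "\<tau> k = \<tau> l"
    \<comment> \<open>If exactly one of the two positions were 1, the other would have to be M + 1,
      which \<open>position_le\<close> excludes.\<close>
    have "position (\<sigma> k) = position (\<sigma> l)"
      using \<tau>[of k] \<tau>[of l] eq ge2[of k] ge2[of l] position_le[of "\<sigma> k"] position_le[of "\<sigma> l"]
      by (auto split: if_splits)
    then show "k = l"
      using inj by (simp add: inj_eq position_eq_iff)
  qed
  then have "bij \<tau>"
    by (simp add: bij_def finite_UNIV_inj_surj)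
  moreover have "fourier_matrix $ \<sigma> (\<tau> k) $ n = cnj (fourier_matrix $ \<sigma> k $ n)" for k n
    using \<tau>[of k] ge2[of k] fourier_matrix_reflect[of "\<sigma> k" "\<sigma> (\<tau> k)" n]
      fourier_matrix_first_real[of "\<sigma> k" n]
    by (auto split: if_splits)
  then have "K_matrix R W $ \<tau> k $ i = cnj (K_matrix R W $ k $ i)" for k i
    by (simp add: K)
  ultimately show thesis
    using that by blast
qed

text \<open>Reindexing the sum over rows by \<open>\<tau>\<close> conjugates every summand, so the
  sum equals its own conjugate.\<close>

lemma K_matrix_gram_real:
  assumes "row_selector R"
  shows "(conj_transpose (K_matrix R W) *v (K_matrix R W *v cvec y)) $ i \<in> \<real>"
proof -
  let ?K = "K_matrix R W"
  define v where "v = ?K *v cvec y"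
  obtain \<tau> where \<tau>: "bij \<tau>" and K: "\<And>k i. ?K $ \<tau> k $ i = cnj (?K $ k $ i)"
    using K_matrix_rows_conjugate[OF assms] by metis
  have v: "v $ \<tau> k = cnj (v $ k)" for k
    by (simp add: v_def matrix_vector_mult_def K)
  have "(conj_transpose ?K *v v) $ i = (\<Sum>k\<in>UNIV. cnj (?K $ k $ i) * v $ k)"
    by (simp add: matrix_vector_mult_def conj_transpose_def)
  also have "\<dots> = (\<Sum>k\<in>UNIV. cnj (?K $ \<tau> k $ i) * v $ \<tau> k)"
    using \<tau> by (rule sum.reindex_bij_betw[symmetric])
  also have "\<dots> = cnj (\<Sum>k\<in>UNIV. cnj (?K $ k $ i) * v $ k)"
    by (simp add: K v)
  also have "(\<Sum>k\<in>UNIV. cnj (?K $ k $ i) * v $ k) = (conj_transpose ?K *v v) $ i"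
    by (simp add: matrix_vector_mult_def conj_transpose_def)
  finally show ?thesis
    by (simp add: v_def complex_is_Real_iff complex_eq_iff)
qed

section \<open>The zero norm and its proximity operator\<close>

lemma l0_eq_sum: "real (l0 x) = (\<Sum>i\<in>UNIV. if x $ i \<noteq> 0 then 1 else 0)"
  by (simp add: l0_def flip: sum.inter_filter)

text \<open>Replacing a nonzero entry of \<open>x\<close> by that of \<open>z\<close> cannot enlarge
  the support, and it removes that entry's share of the squared distance.\<close>

lemma prox_l0_eq_on_support:
  assumes "x \<in> prox_l0 \<beta> z" and "\<beta> > 0" and "x $ i \<noteq> 0"
  shows "x $ i = z $ i"
proof -
  define u where "u = (\<chi> j. if j = i then z $ i else x $ j)"
  have "\<not> 1 / (2 * \<beta>) * (norm (u - z))\<^sup>2 + real (l0 u)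
      < 1 / (2 * \<beta>) * (norm (x - z))\<^sup>2 + real (l0 x)"
    using assms(1) by (simp add: prox_l0_def is_arg_min_def)
  moreover have "l0 u \<le> l0 x"
    unfolding l0_def using assms(3) by (intro card_mono) (auto simp: u_def split: if_splits)
  ultimately have "1 / (2 * \<beta>) * (norm (x - z))\<^sup>2 \<le> 1 / (2 * \<beta>) * (norm (u - z))\<^sup>2"
    by linarith
  then have "(norm (x - z))\<^sup>2 \<le> (norm (u - z))\<^sup>2"
    using assms(2) by (simp add: divide_le_cancel)
  moreover have "(norm (x - z))\<^sup>2 = (norm (u - z))\<^sup>2 + (x $ i - z $ i)\<^sup>2"
    by (simp add: power2_norm_vec sum.remove[of UNIV i] u_def)
  ultimately show ?thesis
    by simp
qed

text \<open>The smooth part is quadratic, so this expansion is exact. Both directions of the theorem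
  use it.\<close>

lemma objective_increment:
  fixes K :: "complex^'n^'d"
  assumes "\<beta> \<noteq> 0"
  shows "objective K r \<beta> \<gamma> (x + dx) (y + dy) - objective K r \<beta> \<gamma> x y =
    dy \<bullet> Re_vec (conj_transpose K *v (K *v cvec y - cvec r)) + 1 / 2 * (norm (K *v cvec dy))\<^sup>2
    + \<gamma> / \<beta> * ((x - y) \<bullet> (dx - dy)) + \<gamma> / (2 * \<beta>) * (norm (dx - dy))\<^sup>2
    + \<gamma> * (real (l0 (x + dx)) - real (l0 x))"
proof -
  have norm_add: "(norm (a + b))\<^sup>2 = (norm a)\<^sup>2 + 2 * (b \<bullet> a) + (norm b)\<^sup>2"
    for a b :: "complex^'d"
    by (simp add: power2_norm_eq_inner algebra_simps inner_commute)
  have "K *v cvec (y + dy) - cvec r = (K *v cvec y - cvec r) + K *v cvec dy"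
    by (simp add: cvec_add matrix_vector_right_distrib)
  then have "(norm (K *v cvec (y + dy) - cvec r))\<^sup>2 = (norm (K *v cvec y - cvec r))\<^sup>2
      + 2 * (dy \<bullet> Re_vec (conj_transpose K *v (K *v cvec y - cvec r))) + (norm (K *v cvec dy))\<^sup>2"
    unfolding conj_transpose_adjoint[symmetric] by (simp only: norm_add)
  moreover have "(norm (x + dx - (y + dy)))\<^sup>2
      = (norm (x - y))\<^sup>2 + 2 * ((x - y) \<bullet> (dx - dy)) + (norm (dx - dy))\<^sup>2"
    by (simp add: power2_norm_eq_inner algebra_simps inner_commute)
  ultimately show ?thesis
    using assms by (simp add: objective_def field_simps)
qed

lemma affine_coeff_zero_of_quadratic_nonneg:
  fixes a b :: real
  assumes "\<And>t. 0 \<le> t * a + t\<^sup>2 * b"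
  shows "a = 0"
proof (rule ccontr)
  assume "a \<noteq> 0"
  \<comment> \<open>At t = -a/c the quadratic equals a^2/c^2 * (b - c), so any positive c above b
    gives a contradiction.\<close>
  define c where "c = \<bar>b\<bar> + 1"
  have c: "c > 0" "b < c" by (auto simp: c_def)
  have "0 \<le> (- a / c) * a + (- a / c)\<^sup>2 * b"
    by (rule assms)
  also have "\<dots> = a\<^sup>2 / c\<^sup>2 * (b - c)"
    using c by (simp add: field_simps power2_eq_square)
  also have "\<dots> < 0"
    using c \<open>a \<noteq> 0\<close> by (intro mult_pos_neg divide_pos_pos) auto
  finally show False by simp
qed

section \<open>Necessary conditions at a global minimizer\<close>

lemma global_minimizer_imp_prox:
  assumes "global_minimizer (objective K r \<beta> \<gamma>) x y" and "\<gamma> > 0"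
  shows "x \<in> prox_l0 \<beta> y"
proof -
  have "1 / (2 * \<beta>) * (norm (x - y))\<^sup>2 + real (l0 x)
      \<le> 1 / (2 * \<beta>) * (norm (u - y))\<^sup>2 + real (l0 u)" for u
  proof -
    have "objective K r \<beta> \<gamma> x y \<le> objective K r \<beta> \<gamma> u y"
      using assms(1) by (simp add: global_minimizer_def)
    then have "\<gamma> * (1 / (2 * \<beta>) * (norm (x - y))\<^sup>2 + real (l0 x))
        \<le> \<gamma> * (1 / (2 * \<beta>) * (norm (u - y))\<^sup>2 + real (l0 u))"
      by (simp add: objective_def distrib_left)
    then show ?thesis
      using assms(2) by (simp only: mult_le_cancel_left_pos)
  qed
  then show ?thesis
    by (simp add: prox_l0_def is_arg_min_def not_less)
qed

lemma global_minimizer_imp_stationary: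
  fixes K :: "complex^'n^'d"
  assumes "global_minimizer (objective K r \<beta> \<gamma>) x y" and "\<beta> > 0" and "\<gamma> > 0"
  shows "y = x - (\<beta> / \<gamma>) *\<^sub>R Re_vec (conj_transpose K *v (K *v cvec y - cvec r))"
proof -
  let ?g = "Re_vec (conj_transpose K *v (K *v cvec y - cvec r))"
  \<comment> \<open>This is the gradient of the objective in \<open>y\<close>. Moving
    \<open>y\<close> along it makes the linear coefficient equal to
    \<open>h \<bullet> h\<close>.\<close>
  define h where "h = ?g - (\<gamma> / \<beta>) *\<^sub>R (x - y)"
  let ?b = "1 / 2 * (norm (K *v cvec h))\<^sup>2 + \<gamma> / (2 * \<beta>) * (norm h)\<^sup>2"
  have "0 \<le> t * (h \<bullet> h) + t\<^sup>2 * ?b" for t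
  proof -
    have "K *v cvec (t *\<^sub>R h) = t *\<^sub>R (K *v cvec h)"
      by (simp add: vec_eq_iff matrix_vector_mult_def scaleR_conv_of_real[where 'a=complex]
          sum_distrib_left mult_ac)
    then have K: "norm (K *v cvec (t *\<^sub>R h)) = \<bar>t\<bar> * norm (K *v cvec h)"
      by simp
    have inner: "(x - y) \<bullet> (0 - t *\<^sub>R h) = - (t * (h \<bullet> (x - y)))"
      by (simp add: inner_commute)
    have "0 \<le> objective K r \<beta> \<gamma> (x + 0) (y + t *\<^sub>R h) - objective K r \<beta> \<gamma> x y"
      using assms(1) by (simp add: global_minimizer_def)
    also have "\<dots> = t * (h \<bullet> ?g - \<gamma> / \<beta> * (h \<bullet> (x - y))) + t\<^sup>2 * ?b"
      unfolding objective_increment[OF less_imp_neq[OF assms(2), symmetric]] K inner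
      by (simp add: power_mult_distrib ring_distribs mult_ac)
    also have "h \<bullet> ?g - \<gamma> / \<beta> * (h \<bullet> (x - y)) = h \<bullet> h"
      \<comment> \<open>Only the last \<open>h\<close> is unfolded, as the second factor of
        \<open>h \<bullet> h\<close>.\<close>
      by (subst (4) h_def) (simp add: inner_diff_right)
    finally show ?thesis .
  qed
  then have "h \<bullet> h = 0"
    by (rule affine_coeff_zero_of_quadratic_nonneg)
  then have "?g = (\<gamma> / \<beta>) *\<^sub>R (x - y)"
    by (simp add: h_def)
  then show ?thesis
    using assms(2,3) by simp
qed

section \<open>Sufficiency for a local minimizer\<close>

lemma prox_stationary_imp_local_minimizer:
  fixes K :: "complex^'n^'d"
  assumes prox: "x \<in> prox_l0 \<beta> y" and "\<beta> > 0" and "\<gamma> > 0"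
    and stat: "y = x - (\<beta> / \<gamma>) *\<^sub>R Re_vec (conj_transpose K *v (K *v cvec y - cvec r))"
  shows "local_minimizer (objective K r \<beta> \<gamma>) x y"
proof -
  let ?g = "Re_vec (conj_transpose K *v (K *v cvec y - cvec r))"
  have "x - y = (\<beta> / \<gamma>) *\<^sub>R ?g"
    using stat by (simp add: algebra_simps)
  then have g: "?g = (\<gamma> / \<beta>) *\<^sub>R (x - y)"
    using assms by simp
  \<comment> \<open>The first bound gives |y_i dx_i| \<le> \<beta> off the support; the others keep
    nonzero entries of \<open>x\<close> nonzero. The 1 keeps the denominator positive when
    \<open>y\<close> is zero.\<close>
  define \<delta> where "\<delta> = Min (insert (\<beta> / (norm y + 1)) ((\<lambda>i. \<bar>x $ i\<bar> / 2) ` {i. x $ i \<noteq> 0}))"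
  have "\<delta> > 0"
    using assms(2) by (auto simp: \<delta>_def add_nonneg_pos)
  have \<delta>_beta: "\<delta> * (norm y + 1) \<le> \<beta>"
  proof -
    have "\<delta> \<le> \<beta> / (norm y + 1)"
      by (simp add: \<delta>_def)
    then show ?thesis
      by (simp add: pos_le_divide_eq add_nonneg_pos)
  qed
  have \<delta>_supp: "\<delta> < \<bar>x $ i\<bar>" if "x $ i \<noteq> 0" for i
  proof -
    have "\<delta> \<le> \<bar>x $ i\<bar> / 2"
      unfolding \<delta>_def using that by (intro Min_le) auto
    then show ?thesis
      using that by linarith
  qed
  \<comment> \<open>Only \<open>dx\<close> has to be small: the terms in \<open>dy\<close> that
    survive are squares.\<close>
  have "objective K r \<beta> \<gamma> x y \<le> objective K r \<beta> \<gamma> (x + dx) (y + dy)"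
    if dx: "norm dx \<le> \<delta>" for dx dy
  proof -
    let ?s = "\<lambda>u i. if u $ i \<noteq> 0 then 1 else (0::real)"
    \<comment> \<open>The linear and counting terms, scaled by \<beta>/\<gamma>, are already
      nonnegative in each coordinate. On the support both vanish.\<close>
    have "0 \<le> (x $ i - y $ i) * dx $ i + \<beta> * (?s (x + dx) i - ?s x i)" for i
    proof -
      have dxi: "\<bar>dx $ i\<bar> \<le> \<delta>"
        using component_le_norm_cart[of dx i] dx by linarith
      show ?thesis
      proof (cases "x $ i = 0")
        case True
        have "\<bar>y $ i\<bar> * \<bar>dx $ i\<bar> \<le> norm y * \<delta>"
          using component_le_norm_cart[of y i] dxi by (intro mult_mono) auto
        also have "\<dots> \<le> \<beta>"
          using \<delta>_beta \<open>\<delta> > 0\<close> by (simp add: algebra_simps)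
        finally have "y $ i * dx $ i \<le> \<beta>"
          by (metis abs_ge_self abs_mult order_trans)
        with True show ?thesis
          by simp
      next
        case False
        then have "x $ i + dx $ i \<noteq> 0"
          using \<delta>_supp[of i] dxi by auto
        with False prox_l0_eq_on_support[OF prox assms(2) False] show ?thesis
          by simp
      qed
    qed
    then have "0 \<le> (\<Sum>i\<in>UNIV. (x $ i - y $ i) * dx $ i + \<beta> * (?s (x + dx) i - ?s x i))"
      by (intro sum_nonneg)
    also have "\<dots> = (x - y) \<bullet> dx + \<beta> * (real (l0 (x + dx)) - real (l0 x))"
      by (simp only: l0_eq_sum inner_vec_def sum.distrib sum_subtractf sum_distrib_left
          right_diff_distrib vector_minus_component inner_real_def)
    finally have "0 \<le> \<gamma> / \<beta> * ((x - y) \<bullet> dx + \<beta> * (real (l0 (x + dx)) - real (l0 x)))"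
      using assms by (intro mult_nonneg_nonneg) auto
    also have "\<dots> = \<gamma> / \<beta> * ((x - y) \<bullet> dx) + \<gamma> * (real (l0 (x + dx)) - real (l0 x))"
      using assms(2) by (simp add: distrib_left)
    also have "\<dots> \<le> \<dots> + 1 / 2 * (norm (K *v cvec dy))\<^sup>2 + \<gamma> / (2 * \<beta>) * (norm (dx - dy))\<^sup>2"
      using assms by simp
    \<comment> \<open>By stationarity the data gradient contributes
      \<open>\<gamma> / \<beta> * (dy \<bullet> (x - y))\<close>, which cancels the linear term in
      \<open>dy\<close> of the coupling.\<close>
    also have "\<dots> = objective K r \<beta> \<gamma> (x + dx) (y + dy) - objective K r \<beta> \<gamma> x y"
      unfolding objective_increment[OF less_imp_neq[OF assms(2), symmetric]] g
      by (simp add: inner_diff_right inner_commute right_diff_distrib)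
    finally show ?thesis
      by simp
  qed
  then show ?thesis
    unfolding local_minimizer_def using \<open>\<delta> > 0\<close> by blast
qed

theorem theorem3:
  fixes R :: "complex^('m::{finite,linorder})^'d"
    and W :: "real^('m::{finite,linorder})^'n"
    and K :: "complex^'n^'d"
    and r :: "real^'d"
    and \<beta> \<gamma> :: real
    and xs ys :: "real^'n"
  assumes "CARD('d) < CARD('m)" and "CARD('m) \<le> CARD('n)"
    and "row_selector R"
    and "tight_framelet W"
    and "K = K_matrix R W"
    and "\<forall>i. (conj_transpose K *v cvec r) $ i \<in> \<real>"
    and "\<beta> > 0" and "\<gamma> > 0"
  shows "(global_minimizer (objective K r \<beta> \<gamma>) xs ys \<longrightarrow>
            xs \<in> prox_l0 \<beta> ys \<and>
            cvec ys = cvec xs - (\<beta> / \<gamma>) *\<^sub>R (conj_transpose K *v (K *v cvec ys - cvec r)))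
       \<and> (xs \<in> prox_l0 \<beta> ys \<and>
            cvec ys = cvec xs - (\<beta> / \<gamma>) *\<^sub>R (conj_transpose K *v (K *v cvec ys - cvec r)) \<longrightarrow>
            local_minimizer (objective K r \<beta> \<gamma>) xs ys)"
proof (intro conjI impI)
  assume gm: "global_minimizer (objective K r \<beta> \<gamma>) xs ys"
  show "xs \<in> prox_l0 \<beta> ys"
    using gm assms(8) by (rule global_minimizer_imp_prox)
  let ?g = "conj_transpose K *v (K *v cvec ys - cvec r)"
  have "?g = conj_transpose K *v (K *v cvec ys) - conj_transpose K *v cvec r"
    by (rule matrix_vector_mult_diff_distrib)
  \<comment> \<open>The Gram part is real by conjugate symmetry, the part from \<open>r\<close> by
    hypothesis. So taking real parts in the stationarity relation loses nothing.\<close>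
  then have real: "Im (?g $ i) = 0" for i
    using K_matrix_gram_real[OF assms(3), of W ys i] assms(5,6)
    by (simp add: complex_is_Real_iff)
  have "ys = xs - (\<beta> / \<gamma>) *\<^sub>R Re_vec ?g"
    using gm assms(7,8) by (rule global_minimizer_imp_stationary)
  then have "ys $ i = xs $ i - \<beta> / \<gamma> * Re (?g $ i)" for i
    by (metis Re_vec_nth real_scaleR_def vector_minus_component vector_scaleR_component)
  then show "cvec ys = cvec xs - (\<beta> / \<gamma>) *\<^sub>R ?g"
    using real by (simp add: vec_eq_iff complex_eq_iff)
next
  let ?g = "conj_transpose K *v (K *v cvec ys - cvec r)"
  assume *: "xs \<in> prox_l0 \<beta> ys \<and> cvec ys = cvec xs - (\<beta> / \<gamma>) *\<^sub>R ?g"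
  then have "Re (cvec ys $ i) = Re ((cvec xs - (\<beta> / \<gamma>) *\<^sub>R ?g) $ i)" for i
    by metis
  then have "ys = xs - (\<beta> / \<gamma>) *\<^sub>R Re_vec ?g"
    by (simp add: vec_eq_iff)
  with * assms(7,8) show "local_minimizer (objective K r \<beta> \<gamma>) xs ys"
    by (intro prox_stationary_imp_local_minimizer) auto
qed

end
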